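(* Let $A_\kappa = \sum_{n=0}^\infty \kappa(S_n)$ (a convergent series). Then $\kappa(S_n) \sim A_\kappa/n^2$ as $n\to\infty$; that is, $n^2\kappa(S_n)\to A_\kappa$ as $n\to\infty$.
   Context: $S_n$ is the symmetric group of degree $n$, with $S_0$ the trivial group, so that $\kappa(S_0)=1$. For a finite group $G$, $\kappa(G)$ denotes the probability that $g$ and $h$ are conjugate in $G$, when $g,h\in G$ are chosen independently and uniformly at random from $G$. *)

theory Defs
  imports
    "HOL-Probability.Probability"
    "HOL-Algebra.Sym_Groups"
    "HOL-Library.Landau_Symbols"
begin

definition conjugate_in :: "('a, 'b) monoid_scheme \<Rightarrow> 'a \<Rightarrow> 'a \<Rightarrow> bool" where
  "conjugate_in G g h \<longleftrightarrow>
     (\<exists>x\<in>carrier G. h = x \<otimes>\<^bsub>G\<^esub> g \<otimes>\<^bsub>G\<^esub> inv\<^bsub>G\<^esub> x)"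

(* Meaningful for finite G only: pmf_of_set is unspecified on infinite sets. *)
definition kappa :: "('a, 'b) monoid_scheme \<Rightarrow> real" where
  "kappa G = measure_pmf.prob
     (pair_pmf (pmf_of_set (carrier G)) (pmf_of_set (carrier G)))
     {(g, h). conjugate_in G g h}"

(* sym_group n acts on {1..n}, so sym_group 0 is the trivial group. *)
definition A_kappa :: real where
  "A_kappa = (\<Sum>n. kappa (sym_group n))"

end

theory Submission
  imports Defs "HOL-Combinatorics.Orbits"
begin

text \<open>  Write \<open>z\<^sub>L\<close> for the order of the centralizer of a permutation of cycle type \<open>L\<close>, and
  \<open>w\<^sub>L = 1 / z\<^sub>L\<close>, the proportion of permutations of cycle type \<open>L\<close>. Two permutations are
  conjugate exactly when their cycle types agree, so \<open>a\<^sub>n = \<kappa>(S\<^sub>n)\<close> is the sum of \<open>w\<^sub>L\<^sup>2\<close> over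
  the partitions \<open>L\<close> of \<open>n\<close> (\<open>kappa_sym_group\<close>).

  The key is to count with a marked point. If \<open>i\<close> is a part of \<open>L\<close> with multiplicity \<open>m\<close>, then
  \<open>w\<close> of \<open>L\<close> with one part \<open>i\<close> deleted equals \<open>i m w\<^sub>L\<close>. As the numbers \<open>i m\<close> add up to \<open>n\<close>,
  the number \<open>n w\<^sub>L\<close> is the sum of the \<open>w\<^bsub>L - i\<^esub>\<close> over the distinct parts \<open>i\<close> of \<open>L\<close>
  (\<open>class_weight_euler\<close>). Squaring this and summing over \<open>L\<close>, the diagonal terms contribute exactly
  \<open>a\<^sub>0 + \<dots> + a\<^bsub>n-1\<^esub>\<close>, because deleting a part \<open>i\<close> leaves an arbitrary partition of \<open>n - i\<close>. In an
  off-diagonal term for parts \<open>i \<noteq> j\<close> both factors are controlled by \<open>w\<close> of \<open>L\<close> with \<open>i\<close> and \<open>j\<close>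
  deleted, and this gives (\<open>kappa_sym_group_bounds\<close>)

    \<open>a\<^sub>0 + \<dots> + a\<^bsub>n-1\<^esub> \<le> n\<^sup>2 a\<^sub>n \<le> a\<^sub>0 + \<dots> + a\<^bsub>n-1\<^esub> + E\<^sub>n\<close>,

  where \<open>E\<^sub>n\<close> is the sum of \<open>a\<^sub>k b\<^bsub>n-k\<^esub>\<close> over \<open>k < n\<close>, and \<open>b\<^sub>s\<close> is the sum of \<open>1/(i j)\<close> over
  the positive \<open>i, j\<close> with \<open>i + j = s\<close>.

  Both remaining facts come from these bounds. Since \<open>b\<^sub>s \<le> 1\<close>, the term \<open>E\<^sub>n\<close> is at most the partial
  sum, so \<open>n\<^sup>2 a\<^sub>n\<close> is at most twice the partial sum; hence the partial sums grow by factors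
  \<open>1 + O(1/n\<^sup>2)\<close>, stay bounded, and the series converges. And since \<open>b\<^sub>s\<close> tends to \<open>0\<close>,
  convergence of the series forces \<open>E\<^sub>n\<close> to tend to \<open>0\<close>, so that \<open>n\<^sup>2 a\<^sub>n\<close> has the same limit as
  the partial sums.

  The two classical facts about cycle types, that they classify conjugacy and that the class sizes are
  \<open>n!/z\<^sub>L\<close>, are both proved by induction on the number of points. The permutations of
  \<open>S \<union> {a}\<close> are the products of the transposition of \<open>a\<close> and \<open>b\<close> with a permutation of \<open>S\<close>, and for
  \<open>b \<in> S\<close> this product lengthens the cycle of \<open>b\<close> by the point \<open>a\<close> and leaves the other
  cycles alone (\<open>orbits_transpose_comp\<close>).\<close>

section \<open>Cycle types and insertion of a point into a cycle\<close>

text \<open>Fixed points of \<open>p\<close> in \<open>S\<close> count as parts \<open>1\<close>, so that the cycle type depends on \<open>S\<close> and not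
  only on \<open>p\<close>.\<close>
definition cycle_type :: "'a set \<Rightarrow> ('a \<Rightarrow> 'a) \<Rightarrow> nat multiset" where
  "cycle_type S p = image_mset card (mset_set (orbit p ` S))"

lemma self_in_orbit_permutes:
  assumes "finite S" "p permutes S"
  shows "x \<in> orbit p x"
  using assms by (intro permutation_self_in_orbit) (auto simp: permutation_permutes)

lemma orbit_eq_of_mem:
  assumes "finite S" "p permutes S" "y \<in> orbit p x"
  shows "orbit p y = orbit p x"
  using assms(3) self_in_orbit_permutes[OF assms(1,2), of x] orbit_swap[of x p y] orbit_trans
  by (metis subsetI subset_antisym)

lemma finite_orbit_permutes:
  assumes "finite S" "p permutes S"
  shows "finite (orbit p x)"
  using self_in_orbit_permutes[OF assms] by (rule finite_orbit)

lemma card_orbit_pos: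
  assumes "finite S" "p permutes S"
  shows "card (orbit p x) > 0"
  using finite_orbit_permutes[OF assms, of x] orbit_nonempty[of p x]
  by (simp add: card_gt_0_iff)

lemma zero_notin_cycle_type:
  assumes "finite S" "p permutes S"
  shows "0 \<notin># cycle_type S p"
  using card_orbit_pos[OF assms] assms(1)
  by (simp add: cycle_type_def image_iff)

lemma orbits_disjoint:
  assumes "finite S" "p permutes S"
  shows "disjoint (orbit p ` S)"
proof (rule disjointI)
  fix X Y assume "X \<in> orbit p ` S" "Y \<in> orbit p ` S" "X \<noteq> Y"
  thus "X \<inter> Y = {}"
    using orbit_eq_of_mem[OF assms] by (metis (no_types, lifting) disjoint_iff imageE)
qed

lemma Union_orbits:
  assumes "finite S" "p permutes S"
  shows "\<Union> (orbit p ` S) = S"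
  using permutes_orbit_subset[OF assms(2)] self_in_orbit_permutes[OF assms] by fastforce

lemma sum_mset_cycle_type:
  assumes "finite S" "p permutes S"
  shows "sum_mset (cycle_type S p) = card S"
proof -
  have "sum_mset (cycle_type S p) = (\<Sum>O'\<in>orbit p ` S. card O')"
    by (simp add: cycle_type_def sum_unfold_sum_mset)
  also have "\<dots> = card (\<Union> (orbit p ` S))"
    using orbits_disjoint[OF assms] finite_orbit_permutes[OF assms]
    by (intro card_Union_disjoint [symmetric]) auto
  finally show ?thesis using Union_orbits[OF assms] by simp
qed

text \<open>The points on cycles of length \<open>k\<close> fall into orbits of \<open>k\<close> points each.\<close>
lemma card_points_with_orbit_size:
  assumes "finite S" "p permutes S"
  shows "card {x \<in> S. card (orbit p x) = k} = k * count (cycle_type S p) k"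
proof -
  let ?C = "{O' \<in> orbit p ` S. card O' = k}"
  have "{x \<in> S. card (orbit p x) = k} = \<Union> ?C"
    using permutes_orbit_subset[OF assms(2)] self_in_orbit_permutes[OF assms]
      orbit_eq_of_mem[OF assms] by fastforce
  also have "card (\<Union> ?C) = (\<Sum>O'\<in>?C. card O')"
    using orbits_disjoint[OF assms] finite_orbit_permutes[OF assms]
    by (intro card_Union_disjoint) (auto simp: pairwise_def disjoint_def)
  also have "\<dots> = k * card ?C" by simp
  also have "card ?C = count (cycle_type S p) k"
    using assms(1) unfolding cycle_type_def
    by (subst count_image_mset) (auto intro!: arg_cong[where f = card])
  finally show ?thesis .
qed

text \<open>Composing \<open>p\<close> with the transposition redirects the arrow that led to \<open>b\<close> so that it leads to \<open>a\<close>,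
  and adds an arrow from \<open>a\<close> to \<open>b\<close>: the point \<open>a\<close> is inserted into the cycle just before \<open>b\<close>.\<close>
lemma orbit_transpose_comp_same:
  assumes "finite S" "p permutes S" "a \<notin> S" "b \<in> S"
  shows "orbit (Transposition.transpose a b \<circ> p) a = insert a (orbit p b)"
proof -
  let ?q = "Transposition.transpose a b \<circ> p"
  have pa: "p a = a" using assms by (simp add: permutes_not_in)
  have sub: "orbit p b \<subseteq> S" using assms permutes_orbit_subset by metis
  have "y \<in> insert a (orbit p b)" if "y \<in> orbit ?q a" for y
    using that
  proof induction
    case base
    then show ?case using pa self_in_orbit_permutes[OF assms(1,2)] by simp
  next
    case (step y)
    show ?case
    proof (cases "y = a")
      case True
      then show ?thesis using pa self_in_orbit_permutes[OF assms(1,2)] by simp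
    next
      case False
      hence "p y \<in> orbit p b" using step by (auto intro: orbit.step)
      moreover from this have "p y \<noteq> a" using sub assms(3) by auto
      ultimately show ?thesis by (cases "p y = b") auto
    qed
  qed
  moreover have "y \<in> orbit ?q a" if "y \<in> orbit p b" for y
  proof -
    have b: "b \<in> orbit ?q a" using orbit.base[of ?q a] pa by simp
    have step: "p y \<in> orbit ?q a" if "y \<in> orbit ?q a" "y \<in> S" for y
    proof (cases "p y = b")
      case False
      moreover have "p y \<noteq> a" using assms that by (metis permutes_in_image)
      ultimately show ?thesis using orbit.step[OF that(1)] by simp
    qed (use b in simp)
    show ?thesis using that
    proof induction
      case base
      show ?case using step[OF b assms(4)] .
    next
      case (step y)
      thus ?case using \<open>y \<in> orbit ?q a \<Longrightarrow> y \<in> S \<Longrightarrow> p y \<in> orbit ?q a\<close> sub by blast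
    qed
  qed
  moreover have "a \<in> orbit ?q a"
  proof -
    have "?q permutes insert a S"
      using permutes_insert[of a S] assms by auto
    thus ?thesis using assms(1) by (intro self_in_orbit_permutes[of "insert a S"]) auto
  qed
  ultimately show ?thesis by blast
qed

text \<open>An orbit of \<open>p\<close> that avoids \<open>b\<close> contains no point on which the two permutations differ, so it
  remains an orbit.\<close>
lemma orbits_transpose_comp:
  assumes "finite S" "p permutes S" "a \<notin> S" "b \<in> S"
  shows "orbit (Transposition.transpose a b \<circ> p) ` insert a S
       = insert (insert a (orbit p b)) (orbit p ` S - {orbit p b})"
proof -
  let ?q = "Transposition.transpose a b \<circ> p"
  have q: "?q permutes insert a S" using permutes_insert[of a S] assms by auto
  have fin: "finite (insert a S)" using assms by simp
  have 1: "orbit ?q x = insert a (orbit p b)" if "x \<in> orbit p b" for x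
    using orbit_transpose_comp_same[OF assms] orbit_eq_of_mem[OF fin q, of x a] that by auto
  have 2: "orbit ?q x = orbit p x" if "x \<in> S" "x \<notin> orbit p b" for x
  proof -
    have "b \<notin> orbit p x" using that orbit_eq_of_mem[OF assms(1,2), of b x]
        self_in_orbit_permutes[OF assms(1,2), of x] by auto
    moreover have "a \<notin> orbit p x" using permutes_orbit_subset[OF assms(2) that(1)] assms(3) by auto
    ultimately have *: "?q y = p y" if "y \<in> orbit p x" for y
      using that by (metis comp_apply orbit.step transpose_apply_other)
    show ?thesis
      using self_in_orbit_permutes[OF assms(1,2), of x] *
      by (intro orbit_cong[of _ p]) (auto)
  qed
  have "orbit ?q ` S = orbit ?q ` orbit p b \<union> orbit ?q ` (S - orbit p b)"
    using permutes_orbit_subset[OF assms(2,4)] by auto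
  also have "orbit ?q ` orbit p b = {insert a (orbit p b)}"
    using 1 self_in_orbit_permutes[OF assms(1,2)] by fastforce
  also have "orbit ?q ` (S - orbit p b) = orbit p ` (S - orbit p b)"
    using 2 by auto
  also have "\<dots> = orbit p ` S - {orbit p b}"
    using orbit_eq_of_mem[OF assms(1,2)] self_in_orbit_permutes[OF assms(1,2)] by blast
  finally have *: "orbit ?q ` S = {insert a (orbit p b)} \<union> (orbit p ` S - {orbit p b})" .
  show ?thesis
    unfolding image_insert * orbit_transpose_comp_same[OF assms] by blast
qed

lemma cycle_type_transpose_comp:
  assumes "finite S" "p permutes S" "a \<notin> S" "b \<in> S"
  shows "cycle_type (insert a S) (Transposition.transpose a b \<circ> p)
       = add_mset (Suc (card (orbit p b))) (cycle_type S p - {#card (orbit p b)#})"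
proof -
  have sub: "x \<in> S \<Longrightarrow> orbit p x \<subseteq> S" for x using assms permutes_orbit_subset by metis
  have "insert a (orbit p b) \<notin> orbit p ` S - {orbit p b}" using sub assms(3) by auto
  moreover have "card (insert a (orbit p b)) = Suc (card (orbit p b))"
    using sub assms finite_orbit_permutes[OF assms(1,2)] by (subst card_insert_disjoint) auto
  moreover have "mset_set (orbit p ` S - {orbit p b}) = mset_set (orbit p ` S) - {#orbit p b#}"
    using assms by (subst mset_set_Diff) auto
  ultimately show ?thesis
    using assms unfolding cycle_type_def orbits_transpose_comp[OF assms]
    by (simp add: image_mset_Diff)
qed

lemma cycle_type_insert_fixed_point:
  assumes "finite S" "p permutes S" "a \<notin> S"
  shows "cycle_type (insert a S) p = add_mset 1 (cycle_type S p)"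
proof -
  have "orbit p a = {a}" using assms by (simp add: orbit_eq_singleton_iff permutes_not_in)
  moreover have "{a} \<notin> orbit p ` S"
    using assms self_in_orbit_permutes[OF assms(1,2)] by fastforce
  ultimately show ?thesis using assms(1) by (simp add: cycle_type_def)
qed

section \<open>Conjugacy in the symmetric group\<close>

lemma card_orbit_transpose_comp:
  assumes "finite S" "p permutes S" "a \<notin> S" "b \<in> S"
  shows "card (orbit (Transposition.transpose a b \<circ> p) a) = Suc (card (orbit p b))"
  using assms permutes_orbit_subset[OF assms(2,4)] finite_orbit_permutes[OF assms(1,2)]
  by (subst orbit_transpose_comp_same[OF assms], subst card_insert_disjoint) auto

text \<open>The inverse of the insertion: \<open>x\<close> is cut out of its cycle by joining its predecessor to its
  successor.\<close>
lemma permutes_remove_point: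
  assumes "p permutes S" "x \<in> S"
  obtains p' where "p' permutes (S - {x})" "p = Transposition.transpose x (p x) \<circ> p'"
proof
  have "insert x (S - {x}) = S" using assms by auto
  thus "Transposition.transpose x (p x) \<circ> p permutes (S - {x})"
    using permutes_insert_lemma[of p x "S - {x}"] assms by simp
  show "p = Transposition.transpose x (p x) \<circ> (Transposition.transpose x (p x) \<circ> p)"
    by (simp flip: comp_assoc)
qed

text \<open>Induction on the number of points: remove \<open>x\<close> and \<open>y\<close> from their cycles, conjugate what remains,
  and send \<open>x\<close> to \<open>y\<close>. To be compatible with the arrows at \<open>x\<close> and \<open>y\<close>, the smaller bijection
  must send \<open>p x\<close> to \<open>q y\<close>. This is why the claim prescribes the image of one point, and it is
  possible to do so precisely because the two cycles stay equally long. The two permutations live on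
  different sets because the sets \<open>A - {x}\<close> and \<open>B - {y}\<close> differ even when \<open>A = B\<close>.\<close>
lemma conjugating_bijection_if_cycle_type_eq:
  assumes "finite A" "finite B" "p permutes A" "q permutes B"
    and "cycle_type A p = cycle_type B q"
    and "x \<in> A" "y \<in> B" "card (orbit p x) = card (orbit q y)"
  shows "\<exists>f. bij_betw f A B \<and> f x = y \<and> (\<forall>z\<in>A. f (p z) = q (f z))"
  using assms
proof (induction "card A" arbitrary: A B p q x y)
  case 0
  then show ?case by auto
next
  case (Suc n A B p q x y)
  note finA = Suc.prems(1) and finB = Suc.prems(2) and xA = Suc.prems(6) and yB = Suc.prems(7)
  let ?A = "A - {x}" and ?B = "B - {y}"
  have insA: "insert x ?A = A" and insB: "insert y ?B = B" using xA yB by auto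
  have finA': "finite ?A" and finB': "finite ?B" using finA finB by auto
  have n: "n = card ?A" using Suc.hyps(2) finA xA by simp
  from permutes_remove_point[OF Suc.prems(3) xA] obtain p' where
    p': "p' permutes ?A" and p: "p = Transposition.transpose x (p x) \<circ> p'" .
  from permutes_remove_point[OF Suc.prems(4) yB] obtain q' where
    q': "q' permutes ?B" and q: "q = Transposition.transpose y (q y) \<circ> q'" .
  have pxA: "p x \<in> A" using Suc.prems(3) xA by (simp add: permutes_in_image)
  have qyB: "q y \<in> B" using Suc.prems(4) yB by (simp add: permutes_in_image)
  have fixed_iff: "p x = x \<longleftrightarrow> card (orbit p x) = 1"
    using self_in_orbit_permutes[OF finA Suc.prems(3), of x]
    by (metis card_1_singletonE is_singletonI is_singleton_altdef orbit_eq_singleton_iff singletonD)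
  have fixed_iff': "q y = y \<longleftrightarrow> card (orbit q y) = 1"
    using self_in_orbit_permutes[OF finB Suc.prems(4), of y]
    by (metis card_1_singletonE is_singletonI is_singleton_altdef orbit_eq_singleton_iff singletonD)
  have ext: "bij_betw (f(x := y)) A B" if "bij_betw f ?A ?B" for f
  proof -
    have "bij_betw (f(x := y)) ?A ?B"
      using that by (subst bij_betw_cong[of _ _ f]) auto
    hence "bij_betw (f(x := y)) (?A \<union> {x}) (?B \<union> {(f(x := y)) x})"
      by (subst notIn_Un_bij_betw3 [symmetric]) auto
    thus ?thesis using insA insB by simp
  qed
  show ?case
  proof (cases "p x = x")
    case True
    hence qy: "q y = y" using fixed_iff fixed_iff' Suc.prems(8) by simp
    have pp: "p = p'" and qq: "q = q'" using True qy p q by simp_all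
    have ct: "cycle_type ?A p' = cycle_type ?B q'"
      using cycle_type_insert_fixed_point[OF finA' p', of x]
        cycle_type_insert_fixed_point[OF finB' q', of y] Suc.prems(5) pp qq
      unfolding insA insB by simp
    \<comment> \<open>Nothing is prescribed now, but the induction hypothesis asks for a pair of points; any two on
      cycles of equal length will do.\<close>
    obtain f where f: "bij_betw f ?A ?B" "\<forall>z\<in>?A. f (p' z) = q' (f z)"
    proof (cases "?A = {}")
      case True
      hence "card ?B = 0"
        using sum_mset_cycle_type[OF finA' p'] sum_mset_cycle_type[OF finB' q'] ct
        by (metis card.empty)
      hence "?B = {}" using finB' by (simp only: card_0_eq)
      with True that[of "\<lambda>z. y"] show ?thesis by (auto simp: bij_betw_def inj_on_def)
    next
      case False
      then obtain u where u: "u \<in> ?A" by blast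
      hence "card (orbit p' u) \<in># cycle_type ?A p'"
        using finA' by (simp add: cycle_type_def)
      then obtain v where "v \<in> ?B" "card (orbit p' u) = card (orbit q' v)"
        unfolding ct using finB' by (auto simp: cycle_type_def)
      from Suc.hyps(1)[OF n finA' finB' p' q' ct u this] that show ?thesis by blast
    qed
    have "(f(x := y)) (p z) = q ((f(x := y)) z)" if "z \<in> A" for z
    proof (cases "z = x")
      case False
      hence "p' z \<in> ?A" using that p' by (metis DiffI permutes_in_image singletonD)
      thus ?thesis using False that f(2) pp qq by simp
    qed (use True qy in simp)
    with ext[OF f(1)] show ?thesis by (intro exI[of _ "f(x := y)"]) auto
  next
    case False
    hence qy: "q y \<noteq> y" using fixed_iff fixed_iff' Suc.prems(8) by simp
    have px_in: "p x \<in> ?A" and qy_in: "q y \<in> ?B" using False qy pxA qyB by auto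
    have eqs: "card (orbit p x) = Suc (card (orbit p' (p x)))"
      "card (orbit q y) = Suc (card (orbit q' (q y)))"
      using card_orbit_transpose_comp[OF finA' p' _ px_in, of x]
        card_orbit_transpose_comp[OF finB' q' _ qy_in, of y] p q by simp_all
    hence sz: "card (orbit p' (p x)) = card (orbit q' (q y))" using Suc.prems(8) by simp
    have mem: "card (orbit p' (p x)) \<in># cycle_type ?A p'"
      "card (orbit q' (q y)) \<in># cycle_type ?B q'"
      using px_in qy_in finA' finB' by (auto simp: cycle_type_def)
    have "cycle_type A p = add_mset (Suc (card (orbit p' (p x))))
              (cycle_type ?A p' - {#card (orbit p' (p x))#})"
      using cycle_type_transpose_comp[OF finA' p' _ px_in, of x] p insA by simp
    moreover have "cycle_type B q = add_mset (Suc (card (orbit q' (q y))))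
              (cycle_type ?B q' - {#card (orbit q' (q y))#})"
      using cycle_type_transpose_comp[OF finB' q' _ qy_in, of y] q insB by simp
    ultimately have ct: "cycle_type ?A p' = cycle_type ?B q'"
      using mem sz Suc.prems(5) by (metis add_mset_add_mset_same_iff insert_DiffM)
    from Suc.hyps(1)[OF n finA' finB' p' q' ct px_in qy_in sz] obtain f where
      f: "bij_betw f ?A ?B" "f (p x) = q y" "\<forall>z\<in>?A. f (p' z) = q' (f z)" by blast
    have "(f(x := y)) (p z) = q ((f(x := y)) z)" if "z \<in> A" for z
    proof (cases "z = x")
      case True
      thus ?thesis using False f(2) by simp
    next
      case zx: False
      hence z: "z \<in> ?A" using that by simp
      hence z': "p' z \<in> ?A" "f z \<in> ?B"
        using f(1) by (simp only: permutes_in_image[OF p'], metis bij_betw_apply)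
      hence z'': "q' (f z) \<in> ?B" using q' by (simp only: permutes_in_image)
      have "p z = Transposition.transpose x (p x) (p' z)" by (subst p) simp
      moreover have "q (f z) = Transposition.transpose y (q y) (q' (f z))" by (subst q) simp
      moreover have "f (p' z) = q' (f z)" using f(3) z by blast
      moreover have "q' (f z) = q y \<longleftrightarrow> p' z = p x"
        using f(1,2) \<open>f (p' z) = q' (f z)\<close> z' px_in by (metis bij_betw_def inj_on_eq_iff)
      ultimately show ?thesis
        using zx z' z'' by (cases "p' z = p x") auto
    qed
    with ext[OF f(1)] show ?thesis by (intro exI[of _ "f(x := y)"]) auto
  qed
qed

lemma orbit_conj:
  assumes "bij f"
  shows "orbit (f \<circ> p \<circ> inv' f) (f x) = f ` orbit p x"
proof -
  have *: "(f \<circ> p \<circ> inv' f) (f z) = f (p z)" for z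
    using assms by (simp add: bij_is_inj)
  have "y \<in> f ` orbit p x" if "y \<in> orbit (f \<circ> p \<circ> inv' f) (f x)" for y
    using that by induction (use * in \<open>auto intro: orbit.intros\<close>)
  moreover have "f y \<in> orbit (f \<circ> p \<circ> inv' f) (f x)" if "y \<in> orbit p x" for y
    using that by induction (metis * orbit.intros)+
  ultimately show ?thesis by auto
qed

lemma cycle_type_conj:
  assumes "finite S" "f permutes S"
  shows "cycle_type S (f \<circ> p \<circ> inv' f) = cycle_type S p"
proof -
  have "bij f" using assms(2) by (rule permutes_bij)
  have "orbit (f \<circ> p \<circ> inv' f) ` S = orbit (f \<circ> p \<circ> inv' f) ` f ` S"
    using assms(2) by (simp add: permutes_image)
  also have "\<dots> = (`) f ` (orbit p ` S)"
    using orbit_conj[OF \<open>bij f\<close>, of p] by (simp add: image_image)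
  finally have *: "orbit (f \<circ> p \<circ> inv' f) ` S = (`) f ` (orbit p ` S)" .
  have "inj_on ((`) f) X" for X
    using \<open>bij f\<close> by (meson bij_is_inj inj_image_eq_iff inj_onI)
  hence "mset_set (orbit (f \<circ> p \<circ> inv' f) ` S) = image_mset ((`) f) (mset_set (orbit p ` S))"
    unfolding * by (rule image_mset_mset_set [symmetric])
  moreover have "card (f ` X) = card X" for X
    using \<open>bij f\<close> by (meson bij_is_inj card_image inj_on_subset subset_UNIV)
  ultimately show ?thesis
    unfolding cycle_type_def by (simp add: image_mset.compositionality comp_def)
qed

lemma conjugate_in_sym_group_iff:
  assumes p: "p permutes {1..n}" and q: "q permutes {1..n}"
  shows "conjugate_in (sym_group n) p q \<longleftrightarrow> cycle_type {1..n} p = cycle_type {1..n} q"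
proof
  assume "conjugate_in (sym_group n) p q"
  then obtain f where "f permutes {1..n}" "q = f \<circ> p \<circ> inv' f"
    by (auto simp: conjugate_in_def sym_group_carrier sym_group_mult sym_group_inv_equality)
  thus "cycle_type {1..n} p = cycle_type {1..n} q" by (simp add: cycle_type_conj)
next
  assume eq: "cycle_type {1..n} p = cycle_type {1..n} q"
  have "\<exists>f. bij_betw f {1..n} {1..n} \<and> (\<forall>z\<in>{1..n}. f (p z) = q (f z))"
  proof (cases "n = 0")
    case False
    hence 1: "1 \<in> {1..n}" by simp
    hence "card (orbit p 1) \<in># cycle_type {1..n} q"
      unfolding eq [symmetric] by (simp add: cycle_type_def)
    then obtain y where "y \<in> {1..n}" "card (orbit p 1) = card (orbit q y)"
      by (auto simp: cycle_type_def)
    from conjugating_bijection_if_cycle_type_eq[OF _ _ p q eq 1 this] show ?thesis by auto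
  qed (simp add: bij_betw_def)
  then obtain g where g: "bij_betw g {1..n} {1..n}" "\<And>z. z \<in> {1..n} \<Longrightarrow> g (p z) = q (g z)"
    by blast
  define f where "f = (\<lambda>z. if z \<in> {1..n} then g z else z)"
  have f: "f permutes {1..n}"
  proof (rule bij_imp_permutes)
    show "bij_betw f {1..n} {1..n}"
      using g(1) by (subst bij_betw_cong[of _ _ g]) (auto simp: f_def)
  qed (auto simp: f_def)
  have "f (p z) = q (f z)" for z
    using g(2)[of z] permutes_in_image[OF p, of z] permutes_not_in[OF p, of z]
      permutes_not_in[OF q, of z] by (auto simp: f_def)
  hence "f \<circ> p = q \<circ> f" by auto
  hence "f \<circ> p \<circ> inv' f = q"
    using permutes_inv_o(1)[OF f] by (simp add: comp_assoc)
  thus "conjugate_in (sym_group n) p q"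
    using f by (auto simp: conjugate_in_def sym_group_carrier sym_group_mult intro!: bexI[of _ f])
qed

section \<open>Sizes of conjugacy classes\<close>

text \<open>The number of ways to rotate each cycle and to permute the cycles of equal length, which is the order of
  the centralizer in the symmetric group of a permutation with cycle type \<open>L\<close>.\<close>
definition centralizer_order :: "nat multiset \<Rightarrow> real" where
  "centralizer_order L = (\<Prod>i\<in>set_mset L. real i ^ count L i * fact (count L i))"

lemma centralizer_order_empty [simp]: "centralizer_order {#} = 1"
  by (simp add: centralizer_order_def)

lemma centralizer_order_add_mset:
  "centralizer_order (add_mset i L) = real i * real (Suc (count L i)) * centralizer_order L"
proof -
  let ?t = "\<lambda>M j. real j ^ count M j * fact (count M j) :: real"
  let ?S = "insert i (set_mset L)"
  have "centralizer_order L = prod (?t L) ?S"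
    unfolding centralizer_order_def
    by (rule prod.mono_neutral_left) (auto simp: not_in_iff)
  also have "\<dots> = ?t L i * prod (?t L) (?S - {i})"
    by (rule prod.remove) auto
  also have "prod (?t L) (?S - {i}) = prod (?t (add_mset i L)) (?S - {i})"
    by (rule prod.cong) auto
  finally have "real i * real (Suc (count L i)) * centralizer_order L
      = ?t (add_mset i L) i * prod (?t (add_mset i L)) (?S - {i})"
    by simp
  also have "\<dots> = prod (?t (add_mset i L)) ?S"
    by (rule prod.remove [symmetric]) auto
  finally show ?thesis by (simp add: centralizer_order_def)
qed

lemma centralizer_order_pos:
  assumes "0 \<notin># L"
  shows "centralizer_order L > 0"
  unfolding centralizer_order_def using assms by (intro prod_pos) (metis fact_gt_zero gr0I mult_pos_pos of_nat_0_less_iff zero_less_power)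

lemma centralizer_order_remove:
  assumes "i \<in># L"
  shows "centralizer_order L = real i * real (count L i) * centralizer_order (L - {#i#})"
  using centralizer_order_add_mset[of i "L - {#i#}"] assms by simp

lemma sum_part_times_count: "(\<Sum>i\<in>set_mset L. i * count L i) = sum_mset L" for L :: "nat multiset"
proof (induction L)
  case (add x L)
  have "(\<Sum>i\<in>set_mset (add_mset x L). i * count (add_mset x L) i)
      = (\<Sum>i\<in>insert x (set_mset L). i * count L i + (if i = x then x else 0))"
    by (intro sum.cong) auto
  also have "\<dots> = (\<Sum>i\<in>insert x (set_mset L). i * count L i) + x"
    by (simp add: sum.distrib)
  also have "(\<Sum>i\<in>insert x (set_mset L). i * count L i) = sum_mset L"
    unfolding add.IH [symmetric] by (rule sum.mono_neutral_right) (auto simp: not_in_iff)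
  finally show ?case by simp
qed simp

definition class_size :: "'a set \<Rightarrow> nat multiset \<Rightarrow> nat" where
  "class_size S L = card {p. p permutes S \<and> cycle_type S p = L}"

lemma bij_betw_permutes_insert:
  assumes "a \<notin> S"
  shows "bij_betw (\<lambda>(b, p). Transposition.transpose a b \<circ> p)
           (insert a S \<times> {p. p permutes S}) {q. q permutes insert a S}"
proof (rule bij_betw_imageI)
  show "inj_on (\<lambda>(b, p). Transposition.transpose a b \<circ> p) (insert a S \<times> {p. p permutes S})"
  proof (rule inj_onI; clarify)
    fix b p c q
    assume *: "p permutes S" "q permutes S"
      "Transposition.transpose a b \<circ> p = Transposition.transpose a c \<circ> q"
    have "p a = a" "q a = a" using *(1,2) assms by (simp_all add: permutes_not_in)
    with fun_cong[OF *(3), of a] have "b = c" by simp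
    moreover from this have "p = q"
      using *(3) by (metis comp_assoc id_comp transpose_comp_involutory)
    ultimately show "b = c \<and> p = q" by simp
  qed
qed (auto simp: permutes_insert)

text \<open>Sort the ways of obtaining a permutation of type \<open>L\<close> by insertion of \<open>a\<close> according to the length
  \<open>j\<close> of the cycle of \<open>a\<close> in the result. For \<open>j = 1\<close> the point \<open>a\<close> is fixed, and the rest has
  type \<open>L\<close> without one part \<open>1\<close>. For \<open>j = i + 1\<close> the rest has a part \<open>i\<close> in place of a part \<open>j\<close>,
  and \<open>b\<close> is any point on a cycle of length \<open>i\<close>; the number of such points is just the factor by which
  the centralizer order changes when a part \<open>i\<close> is added. So in either case the count is \<open>|S|!\<close>
  divided by the centralizer order of \<open>L\<close> without \<open>j\<close>.\<close>
lemma card_insertions_with_marked_cycle: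
  assumes S: "finite S" "a \<notin> S" and j: "j \<in># L" and L: "0 \<notin># L" "sum_mset L = Suc (card S)"
    and IH: "\<And>M. 0 \<notin># M \<Longrightarrow> sum_mset M = card S \<Longrightarrow>
               real (class_size S M) * centralizer_order M = fact (card S)"
  shows "real (card {(b, p). b \<in> insert a S \<and> p permutes S \<and>
               cycle_type (insert a S) (Transposition.transpose a b \<circ> p) = L \<and>
               card (orbit (Transposition.transpose a b \<circ> p) a) = j}) * centralizer_order L
         = fact (card S) * real (j * count L j)" (is "real (card ?T) * _ = _")
proof -
  obtain K where LK: "L = add_mset j K" using j by (metis multi_member_split)
  have K: "0 \<notin># K" "j \<noteq> 0" using L(1) LK by auto
  have sumK: "j + sum_mset K = Suc (card S)"
    using L(2) LK by simp
  have zL: "centralizer_order L = real (j * count L j) * centralizer_order K"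
    using centralizer_order_add_mset[of j K] LK by (simp add: algebra_simps)
  show ?thesis
  proof (cases "j = 1")
    case True
    have mem: "(b, p) \<in> ?T \<longleftrightarrow> (b, p) \<in> {a} \<times> {p. p permutes S \<and> cycle_type S p = K}" for b p
    proof (cases "b = a")
      case b: True
      have "card (orbit p a) = 1" if "p permutes S"
      proof -
        have "orbit p a = {a}" using that S by (simp add: orbit_eq_singleton_iff permutes_not_in)
        thus ?thesis by simp
      qed
      thus ?thesis
        using b cycle_type_insert_fixed_point[OF S(1) _ S(2)] True LK by auto
    next
      case False
      thus ?thesis
        using card_orbit_transpose_comp[OF S(1) _ S(2), of p b] card_orbit_pos[OF S(1), of p b] True
        by auto
    qed
    have "?T = {a} \<times> {p. p permutes S \<and> cycle_type S p = K}"
    proof (rule Set.set_eqI)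
      fix x show "x \<in> ?T \<longleftrightarrow> x \<in> {a} \<times> {p. p permutes S \<and> cycle_type S p = K}"
        using mem[of "fst x" "snd x"] by (simp only: prod.collapse)
    qed
    hence "card ?T = class_size S K" by (simp add: class_size_def card_cartesian_product)
    thus ?thesis using IH[OF K(1)] sumK True zL by simp
  next
    case False
    with K(2) obtain i where i: "j = Suc i" "i > 0" by (cases j) auto
    define M where "M = add_mset i K"
    have M: "0 \<notin># M" "sum_mset M = card S" using K(1) sumK i by (auto simp: M_def)
    have mem: "(b, p) \<in> ?T \<longleftrightarrow>
      (b, p) \<in> (SIGMA p : {p. p permutes S \<and> cycle_type S p = M}. {b \<in> S. card (orbit p b) = i})\<inverse>" for b p
    proof (cases "p permutes S \<and> b \<in> S")
      case True
      hence "card (orbit p b) \<in># cycle_type S p"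
        using S(1) by (simp add: cycle_type_def)
      then obtain R where R: "cycle_type S p = add_mset (card (orbit p b)) R"
        by (metis multi_member_split)
      hence "cycle_type (insert a S) (Transposition.transpose a b \<circ> p)
           = add_mset (Suc (card (orbit p b))) R"
        using True cycle_type_transpose_comp[OF S(1) _ S(2), of p b] by simp
      moreover have "card (orbit (Transposition.transpose a b \<circ> p) a) = Suc (card (orbit p b))"
        using True card_orbit_transpose_comp[OF S(1) _ S(2), of p b] by simp
      ultimately show ?thesis
        using True R LK i(1) by (auto simp: M_def)
    next
      case False
      have "card (orbit p a) = 1" if "p permutes S"
      proof -
        have "orbit p a = {a}" using that S by (simp add: orbit_eq_singleton_iff permutes_not_in)
        thus ?thesis by simp
      qed
      thus ?thesis using False \<open>j \<noteq> 1\<close> by auto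
    qed
    have "?T = (SIGMA p : {p. p permutes S \<and> cycle_type S p = M}. {b \<in> S. card (orbit p b) = i})\<inverse>"
    proof (rule Set.set_eqI)
      fix x show "x \<in> ?T \<longleftrightarrow>
          x \<in> (SIGMA p : {p. p permutes S \<and> cycle_type S p = M}. {b \<in> S. card (orbit p b) = i})\<inverse>"
        using mem[of "fst x" "snd x"] by (simp only: prod.collapse)
    qed
    hence "card ?T = card (SIGMA p : {p. p permutes S \<and> cycle_type S p = M}. {b \<in> S. card (orbit p b) = i})"
      by (simp add: card_inverse)
    also have "\<dots> = (\<Sum>p\<in>{p. p permutes S \<and> cycle_type S p = M}. card {b \<in> S. card (orbit p b) = i})"
      using S(1) by (intro card_SigmaI) (auto intro: finite_subset[OF _ finite_permutations])
    also have "\<dots> = (\<Sum>p\<in>{p. p permutes S \<and> cycle_type S p = M}. i * count M i)"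
      using card_points_with_orbit_size[OF S(1)] by (intro sum.cong) auto
    also have "\<dots> = class_size S M * (i * Suc (count K i))" by (simp add: class_size_def M_def)
    finally have "real (card ?T) = real (class_size S M) * (real i * real (Suc (count K i)))"
      by (simp only: of_nat_mult)
    moreover have "centralizer_order M = real i * real (Suc (count K i)) * centralizer_order K"
      unfolding M_def by (rule centralizer_order_add_mset)
    ultimately have "real (card ?T) * centralizer_order K = fact (card S)"
      using IH[OF M] by (simp add: mult_ac)
    thus ?thesis using zL by (simp add: mult_ac)
  qed
qed

text \<open>The contributions of the possible lengths \<open>j\<close> of the cycle of the new point are proportional to
  \<open>j\<close> times its multiplicity, and these numbers add up to the number of points.\<close>
lemma class_size_times_centralizer_order:
  assumes "finite S" "0 \<notin># L" "sum_mset L = card S"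
  shows "real (class_size S L) * centralizer_order L = fact (card S)"
  using assms
proof (induction S arbitrary: L rule: finite_induct)
  case empty
  hence "L = {#}" by (cases L) auto
  thus ?case by (simp add: class_size_def cycle_type_def)
next
  case (insert a S L)
  let ?ins = "\<lambda>(b, p). Transposition.transpose a b \<circ> p"
  let ?T = "\<lambda>j. {(b, p). b \<in> insert a S \<and> p permutes S \<and>
               cycle_type (insert a S) (Transposition.transpose a b \<circ> p) = L \<and>
               card (orbit (Transposition.transpose a b \<circ> p) a) = j}"
  let ?C = "{q. q permutes insert a S \<and> cycle_type (insert a S) q = L}"
  note bij = bij_betw_permutes_insert[OF insert.hyps(2)]
  have finT: "finite (?T j)" for j
  proof (rule finite_subset)
    show "?T j \<subseteq> insert a S \<times> {p. p permutes S}" by auto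
    show "finite (insert a S \<times> {p. p permutes S})"
      using insert.hyps(1) by (simp add: finite_permutations)
  qed
  have "?ins ` (\<Union>j\<in>set_mset L. ?T j) = ?C"
  proof (intro equalityI subsetI)
    fix q assume "q \<in> ?ins ` (\<Union>j\<in>set_mset L. ?T j)"
    then obtain b p where bp: "q = Transposition.transpose a b \<circ> p" "b \<in> insert a S" "p permutes S"
      "cycle_type (insert a S) q = L" by auto
    hence "q \<in> ?ins ` (insert a S \<times> {p. p permutes S})"
      by (intro rev_image_eqI[of "(b, p)"]) simp_all
    with bij bp(4) show "q \<in> ?C" by (simp add: bij_betw_def)
  next
    fix q assume q: "q \<in> ?C"
    hence "q \<in> ?ins ` (insert a S \<times> {p. p permutes S})" using bij by (simp add: bij_betw_def)
    then obtain b p where bp: "q = Transposition.transpose a b \<circ> p" "b \<in> insert a S" "p permutes S"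
      by auto
    moreover have "card (orbit q a) \<in># L" using q insert.hyps(1) by (auto simp: cycle_type_def)
    ultimately have "(b, p) \<in> (\<Union>j\<in>set_mset L. ?T j)" using q by auto
    thus "q \<in> ?ins ` (\<Union>j\<in>set_mset L. ?T j)" by (rule rev_image_eqI) (simp add: bp(1))
  qed
  moreover have "inj_on ?ins (\<Union>j\<in>set_mset L. ?T j)"
    using bij unfolding bij_betw_def by (elim conjE inj_on_subset) auto
  ultimately have "class_size (insert a S) L = card (\<Union>j\<in>set_mset L. ?T j)"
    unfolding class_size_def using card_image[of ?ins "\<Union>j\<in>set_mset L. ?T j"] by simp
  also have "\<dots> = (\<Sum>j\<in>set_mset L. card (?T j))"
    using finT by (intro card_UN_disjoint) auto
  finally have "real (class_size (insert a S) L) * centralizer_order L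
      = (\<Sum>j\<in>set_mset L. real (card (?T j)) * centralizer_order L)"
    by (simp add: sum_distrib_right)
  also have "\<dots> = (\<Sum>j\<in>set_mset L. fact (card S) * real (j * count L j))"
    using insert.prems insert.IH insert.hyps
    by (intro sum.cong refl card_insertions_with_marked_cycle) auto
  also have "\<dots> = fact (card S) * real (sum_mset L)"
    by (simp only: sum_distrib_left [symmetric] of_nat_sum [symmetric] sum_part_times_count)
  also have "\<dots> = fact (card (insert a S))"
    using insert by (simp add: mult.commute)
  finally show ?case .
qed

section \<open>Inequalities for the conjugacy probability\<close>

definition partitions_of :: "nat \<Rightarrow> nat multiset set" where
  "partitions_of n = {L. 0 \<notin># L \<and> sum_mset L = n}"

text \<open>Every partition occurs because the class size formula shows that its class is not empty.\<close>
lemma cycle_types_eq_partitions: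
  assumes "finite S"
  shows "cycle_type S ` {p. p permutes S} = partitions_of (card S)"
proof (intro equalityI subsetI)
  fix L assume L: "L \<in> partitions_of (card S)"
  hence "class_size S L \<noteq> 0"
    using class_size_times_centralizer_order[OF assms, of L]
    by (intro notI) (simp add: partitions_of_def)
  hence "{p. p permutes S \<and> cycle_type S p = L} \<noteq> {}"
    unfolding class_size_def by (metis card.empty)
  thus "L \<in> cycle_type S ` {p. p permutes S}" by auto
next
  fix L assume "L \<in> cycle_type S ` {p. p permutes S}"
  thus "L \<in> partitions_of (card S)"
    using zero_notin_cycle_type[OF assms] sum_mset_cycle_type[OF assms]
    by (auto simp: partitions_of_def)
qed

lemma finite_partitions_of: "finite (partitions_of n)"
proof -
  have "finite (cycle_type {1..n} ` {p. p permutes {1..n}})" by (simp add: finite_permutations)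
  thus ?thesis using cycle_types_eq_partitions[of "{1..n}"] by simp
qed

text \<open>The proportion of permutations that have cycle type \<open>L\<close>.\<close>
abbreviation class_weight :: "nat multiset \<Rightarrow> real" where
  "class_weight L \<equiv> inverse (centralizer_order L)"

text \<open>The pairs of conjugate permutations are the pairs that lie in a common class, and the class of
  \<open>L\<close> makes up the proportion \<open>class_weight L\<close> of the group.\<close>
lemma kappa_sym_group: "kappa (sym_group n) = (\<Sum>L\<in>partitions_of n. (class_weight L)\<^sup>2)"
proof -
  let ?G = "carrier (sym_group n)"
  let ?cls = "\<lambda>L. {p. p permutes {1..n} \<and> cycle_type {1..n} p = L}"
  have G: "?G = {p. p permutes {1..n}}" by (auto simp: sym_group_carrier)
  have fin: "finite ?G" unfolding G by (simp add: finite_permutations)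
  have ne: "?G \<noteq> {}" unfolding G using permutes_id by blast
  have cardG: "card ?G = fact n" unfolding G by (simp add: card_permutations)
  have fincls: "finite (?cls L)" for L using fin unfolding G by simp
  have part: "cycle_type {1..n} g \<in> partitions_of n" if "g permutes {1..n}" for g
    using cycle_types_eq_partitions[of "{1..n}"] that by (simp add: set_eq_iff image_iff) metis
  have pairs: "(?G \<times> ?G) \<inter> {(g, h). conjugate_in (sym_group n) g h}
      = (\<Union>L\<in>partitions_of n. ?cls L \<times> ?cls L)"
    unfolding G using part by (auto simp: conjugate_in_sym_group_iff)
  have "card (\<Union>L\<in>partitions_of n. ?cls L \<times> ?cls L) = (\<Sum>L\<in>partitions_of n. card (?cls L \<times> ?cls L))"
  proof (rule card_UN_disjoint)
    show "finite (partitions_of n)" by (rule finite_partitions_of)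
    show "\<forall>L\<in>partitions_of n. finite (?cls L \<times> ?cls L)"
      using fincls by (intro ballI finite_cartesian_product)
    show "\<forall>L\<in>partitions_of n. \<forall>M\<in>partitions_of n. L \<noteq> M \<longrightarrow>
            (?cls L \<times> ?cls L) \<inter> (?cls M \<times> ?cls M) = {}"
      by blast
  qed
  hence "real (card ((?G \<times> ?G) \<inter> {(g, h). conjugate_in (sym_group n) g h}))
      = (\<Sum>L\<in>partitions_of n. (real (class_size {1..n} L))\<^sup>2)"
    unfolding pairs by (simp only: card_cartesian_product class_size_def power2_eq_square of_nat_sum of_nat_mult)
  moreover have "pair_pmf (pmf_of_set ?G) (pmf_of_set ?G) = pmf_of_set (?G \<times> ?G)"
  proof (rule pmf_eqI)
    fix x
    show "pmf (pair_pmf (pmf_of_set ?G) (pmf_of_set ?G)) x = pmf (pmf_of_set (?G \<times> ?G)) x"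
      using fin ne by (cases x) (simp add: pmf_pair card_cartesian_product indicator_def)
  qed
  ultimately have "kappa (sym_group n)
      = (\<Sum>L\<in>partitions_of n. (real (class_size {1..n} L))\<^sup>2) / (fact n)\<^sup>2"
    unfolding kappa_def using fin ne cardG
    by (simp add: measure_pmf_of_set card_cartesian_product power2_eq_square)
  also have "\<dots> = (\<Sum>L\<in>partitions_of n. (class_weight L)\<^sup>2)"
    unfolding sum_divide_distrib
  proof (rule sum.cong)
    fix L assume "L \<in> partitions_of n"
    hence "real (class_size {1..n} L) * centralizer_order L = fact n" "centralizer_order L > 0"
      using class_size_times_centralizer_order[of "{1..n}" L] centralizer_order_pos
      by (auto simp: partitions_of_def)
    hence "real (class_size {1..n} L) / fact n = class_weight L"
      by (simp add: field_simps)
    thus "(real (class_size {1..n} L))\<^sup>2 / (fact n)\<^sup>2 = (class_weight L)\<^sup>2"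
      by (simp flip: power_divide)
  qed simp
  finally show ?thesis .
qed

lemma class_weight_remove:
  assumes "0 \<notin># L" "i \<in># L"
  shows "class_weight (L - {#i#}) = real (i * count L i) * class_weight L"
proof -
  have "i \<noteq> 0" using assms by metis
  thus ?thesis using centralizer_order_remove[OF assms(2)] assms(2) by (simp add: field_simps)
qed

text \<open>Both sides count, relative to \<open>n!\<close>, the permutations of type \<open>L\<close> with one marked point; on the
  right, they are sorted by the length of the cycle through that point.\<close>
lemma class_weight_euler:
  assumes "L \<in> partitions_of n"
  shows "real n * class_weight L = (\<Sum>i\<in>set_mset L. class_weight (L - {#i#}))"
proof -
  have "(\<Sum>i\<in>set_mset L. class_weight (L - {#i#}))
      = (\<Sum>i\<in>set_mset L. real (i * count L i) * class_weight L)"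
    using assms by (intro sum.cong refl class_weight_remove) (auto simp: partitions_of_def)
  also have "\<dots> = real (\<Sum>i\<in>set_mset L. i * count L i) * class_weight L"
    by (simp only: sum_distrib_right of_nat_sum)
  finally show ?thesis using assms
    by (simp only: partitions_of_def mem_Collect_eq sum_part_times_count)
qed

text \<open>A partition of \<open>n\<close> with one of its part sizes \<open>i\<close> singled out is the same as a positive
  \<open>i \<le> n\<close> together with a partition of \<open>n - i\<close>.\<close>
lemma sum_partitions_remove_part:
  fixes g :: "nat \<Rightarrow> nat multiset \<Rightarrow> real"
  shows "(\<Sum>L\<in>partitions_of n. \<Sum>i\<in>set_mset L. g i (L - {#i#}))
       = (\<Sum>i=1..n. \<Sum>M\<in>partitions_of (n - i). g i M)"
proof -
  have remove: "i \<in> {1..n} \<and> L - {#i#} \<in> partitions_of (n - i)"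
    if L: "L \<in> partitions_of n" and i: "i \<in># L" for L i
  proof -
    obtain M where "L = add_mset i M" using i by (metis multi_member_split)
    thus ?thesis using L by (auto simp: partitions_of_def)
  qed
  have "(\<Sum>L\<in>partitions_of n. \<Sum>i\<in>set_mset L. g i (L - {#i#}))
      = (\<Sum>(L, i)\<in>(SIGMA L : partitions_of n. set_mset L). g i (L - {#i#}))"
    by (rule sum.Sigma) (auto simp: finite_partitions_of)
  also have "\<dots> = (\<Sum>(i, M)\<in>(SIGMA i : {1..n}. partitions_of (n - i)). g i M)"
    by (rule sum.reindex_bij_witness[where
          i = "\<lambda>(i, M). (add_mset i M, i)" and j = "\<lambda>(L, i). (i, L - {#i#})"])
       (use remove in \<open>auto simp: partitions_of_def\<close>)
  also have "\<dots> = (\<Sum>i=1..n. \<Sum>M\<in>partitions_of (n - i). g i M)"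
    by (rule sum.Sigma [symmetric]) (auto simp: finite_partitions_of)
  finally show ?thesis .
qed

text \<open>Deleting \<open>j\<close> from \<open>L\<close> without \<open>i\<close> multiplies the weight by \<open>j\<close> times a multiplicity that is at
  least \<open>1\<close>, since \<open>j\<close> is still present; the same holds with \<open>i\<close> and \<open>j\<close> exchanged.\<close>
lemma class_weight_cross_term_le:
  assumes L: "0 \<notin># L" and i: "i \<in># L" and j: "j \<in># L" "j \<noteq> i"
  shows "class_weight (L - {#i#}) * class_weight (L - {#j#})
       \<le> (class_weight (L - {#i#} - {#j#}))\<^sup>2 / (real i * real j)"
proof -
  let ?M = "L - {#i#} - {#j#}"
  have pos: "i > 0" "j > 0" using L i j by (auto intro: gr0I)
  have M0: "0 \<notin># ?M" using L by (auto dest: in_diffD)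
  have *: "class_weight (L - {#k#}) \<le> class_weight ?M / real l"
    if "(k = i \<and> l = j) \<or> (k = j \<and> l = i)" for k l
  proof -
    have "l \<in># L" "l \<noteq> k" "l > 0" using that i j pos by auto
    hence l: "l \<in># L - {#k#}" by (simp add: in_diff_count flip: count_greater_zero_iff)
    have eq: "L - {#k#} - {#l#} = ?M" using that diff_right_commute by blast
    have "0 \<notin># L - {#k#}" using L by (auto dest: in_diffD)
    from class_weight_remove[OF this l] have
      "class_weight ?M = real (count (L - {#k#}) l) * (real l * class_weight (L - {#k#}))"
      unfolding eq by simp
    moreover have "class_weight (L - {#k#}) > 0"
      using centralizer_order_pos[OF \<open>0 \<notin># L - {#k#}\<close>] by simp
    moreover have "real (count (L - {#k#}) l) \<ge> 1" using l
      by (metis count_greater_eq_one_iff of_nat_1 of_nat_le_iff)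
    ultimately have "real l * class_weight (L - {#k#}) \<le> class_weight ?M"
      using mult_right_mono[of 1 "real (count (L - {#k#}) l)" "real l * class_weight (L - {#k#})"]
      by (simp only: mult_1 mult_nonneg_nonneg of_nat_0_le_iff less_imp_le)
    thus ?thesis using \<open>l > 0\<close>
      by (subst pos_le_divide_eq) (simp_all only: mult.commute of_nat_0_less_iff)
  qed
  have "class_weight (L - {#i#}) * class_weight (L - {#j#})
      \<le> (class_weight ?M / real j) * (class_weight ?M / real i)"
    using * centralizer_order_pos[of "L - {#j#}"] L centralizer_order_pos[OF M0]
    by (intro mult_mono) (auto dest: in_diffD intro: less_imp_le)
  thus ?thesis by (simp add: power2_eq_square mult_ac)
qed

text \<open>The sum of the squares of \<open>class_weight_euler\<close> over all partitions of \<open>n\<close>: the lower bound keeps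
  only the diagonal terms, which can be evaluated exactly, and the upper bound estimates the others.\<close>
lemma kappa_sym_group_bounds:
  defines "a \<equiv> \<lambda>n. kappa (sym_group n)"
  shows "(\<Sum>k<n. a k) \<le> (real n)\<^sup>2 * a n"
    and "(real n)\<^sup>2 * a n \<le> (\<Sum>k<n. a k) + (\<Sum>i=1..n. \<Sum>j=1..n-i. a (n - i - j) / (real i * real j))"
proof -
  let ?w = class_weight
  let ?D = "\<lambda>L. \<Sum>i\<in>set_mset L. (?w (L - {#i#}))\<^sup>2"
  let ?E = "\<lambda>L. \<Sum>i\<in>set_mset L. \<Sum>j\<in>set_mset L - {i}. ?w (L - {#i#}) * ?w (L - {#j#})"
  have split: "(real n * ?w L)\<^sup>2 = ?D L + ?E L" if "L \<in> partitions_of n" for L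
  proof -
    have "(real n * ?w L)\<^sup>2 = (\<Sum>i\<in>set_mset L. \<Sum>j\<in>set_mset L. ?w (L - {#i#}) * ?w (L - {#j#}))"
      unfolding class_weight_euler[OF that] by (simp add: power2_eq_square sum_product)
    also have "\<dots> = (\<Sum>i\<in>set_mset L. (?w (L - {#i#}))\<^sup>2
          + (\<Sum>j\<in>set_mset L - {i}. ?w (L - {#i#}) * ?w (L - {#j#})))"
      by (intro sum.cong refl) (simp add: sum.remove power2_eq_square)
    finally show ?thesis by (simp add: sum.distrib)
  qed
  have "(real n)\<^sup>2 * a n = (\<Sum>L\<in>partitions_of n. (real n * ?w L)\<^sup>2)"
    by (simp add: a_def kappa_sym_group sum_distrib_left power_mult_distrib)
  also have "\<dots> = (\<Sum>L\<in>partitions_of n. ?D L) + (\<Sum>L\<in>partitions_of n. ?E L)"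
    by (simp add: split sum.distrib)
  also have "(\<Sum>L\<in>partitions_of n. ?D L) = (\<Sum>i=1..n. a (n - i))"
    unfolding a_def kappa_sym_group by (rule sum_partitions_remove_part)
  also have "\<dots> = (\<Sum>k<n. a k)"
    by (rule sum.reindex_bij_witness[where i = "\<lambda>k. n - k" and j = "\<lambda>i. n - i"]) auto
  finally have eq: "(real n)\<^sup>2 * a n = (\<Sum>k<n. a k) + (\<Sum>L\<in>partitions_of n. ?E L)" .
  have w_nonneg: "?w M \<ge> 0" for M
    unfolding centralizer_order_def by (simp add: prod_nonneg)
  have "(\<Sum>L\<in>partitions_of n. ?E L) \<ge> 0"
    by (intro sum_nonneg mult_nonneg_nonneg w_nonneg)
  with eq show "(\<Sum>k<n. a k) \<le> (real n)\<^sup>2 * a n" by simp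
  have "(\<Sum>L\<in>partitions_of n. ?E L) \<le> (\<Sum>L\<in>partitions_of n. \<Sum>i\<in>set_mset L.
      \<Sum>j\<in>set_mset (L - {#i#}). (?w (L - {#i#} - {#j#}))\<^sup>2 / (real i * real j))"
  proof (intro sum_mono)
    fix L i assume L: "L \<in> partitions_of n" and i: "i \<in> set_mset L"
    have "(\<Sum>j\<in>set_mset L - {i}. ?w (L - {#i#}) * ?w (L - {#j#}))
        \<le> (\<Sum>j\<in>set_mset L - {i}. (?w (L - {#i#} - {#j#}))\<^sup>2 / (real i * real j))"
      using L i by (intro sum_mono class_weight_cross_term_le) (auto simp: partitions_of_def)
    \<comment> \<open>Admitting \<open>j = i\<close> when \<open>i\<close> is a repeated part makes the sum run over all parts of the
      remaining partition, as needed to apply the reindexing a second time.\<close>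
    also have "\<dots> \<le> (\<Sum>j\<in>set_mset (L - {#i#}). (?w (L - {#i#} - {#j#}))\<^sup>2 / (real i * real j))"
    proof (rule sum_mono2)
      obtain M where "L = add_mset i M" using i by (metis multi_member_split)
      thus "set_mset L - {i} \<subseteq> set_mset (L - {#i#})" by auto
    qed auto
    finally show "(\<Sum>j\<in>set_mset L - {i}. ?w (L - {#i#}) * ?w (L - {#j#}))
        \<le> (\<Sum>j\<in>set_mset (L - {#i#}). (?w (L - {#i#} - {#j#}))\<^sup>2 / (real i * real j))" .
  qed
  also have "\<dots> = (\<Sum>i=1..n. \<Sum>M\<in>partitions_of (n - i).
      \<Sum>j\<in>set_mset M. (?w (M - {#j#}))\<^sup>2 / (real i * real j))"
    by (rule sum_partitions_remove_part)
  also have "\<dots> = (\<Sum>i=1..n. \<Sum>j=1..n-i. \<Sum>M\<in>partitions_of (n - i - j). (?w M)\<^sup>2 / (real i * real j))"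
    by (intro sum.cong refl sum_partitions_remove_part)
  also have "\<dots> = (\<Sum>i=1..n. \<Sum>j=1..n-i. a (n - i - j) / (real i * real j))"
    by (simp add: a_def kappa_sym_group sum_divide_distrib)
  finally show "(real n)\<^sup>2 * a n
      \<le> (\<Sum>k<n. a k) + (\<Sum>i=1..n. \<Sum>j=1..n-i. a (n - i - j) / (real i * real j))"
    using eq by simp
qed

section \<open>Sequences governed by their partial sums\<close>

definition pair_weight :: "nat \<Rightarrow> real" where
  "pair_weight s = (\<Sum>i\<in>{1..<s}. 1 / (real i * real (s - i)))"

lemma pair_weight_nonneg: "pair_weight s \<ge> 0"
  unfolding pair_weight_def by (intro sum_nonneg) auto

text \<open>There are \<open>s - 1\<close> summands, and \<open>i (s - i) \<ge> s - 1\<close> for each of them.\<close>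
lemma pair_weight_le_one: "pair_weight s \<le> 1"
proof (cases "s \<le> 1")
  case False
  have "1 / (real i * real (s - i)) \<le> 1 / real (s - 1)" if "i \<in> {1..<s}" for i
  proof -
    have "s - 1 \<le> i * (s - i)"
    proof -
      define u v where "u = i - 1" and "v = s - i - 1"
      hence "i = Suc u" "s = Suc u + Suc v" using that by auto
      thus ?thesis by simp
    qed
    hence "real (s - 1) \<le> real i * real (s - i)" by (metis of_nat_le_iff of_nat_mult)
    thus ?thesis using False that by (intro divide_left_mono) auto
  qed
  hence "pair_weight s \<le> (\<Sum>i\<in>{1..<s}. 1 / real (s - 1))"
    unfolding pair_weight_def by (rule sum_mono)
  also have "\<dots> = 1" using False by simp
  finally show ?thesis .
qed (simp add: pair_weight_def)

text \<open>Since \<open>1/(i (s - i)) = (1/i + 1/(s - i))/s\<close>, the weight is at most twice a harmonic number divided by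
  \<open>s\<close>, and harmonic numbers grow like the logarithm.\<close>
lemma pair_weight_tendsto_zero: "pair_weight \<longlonglongrightarrow> 0"
proof (rule tendsto_sandwich[OF _ _ tendsto_const])
  have "pair_weight s \<le> 2 * (harm s / real s)" for s
  proof -
    have "pair_weight s = (\<Sum>i\<in>{1..<s}. (1 / real i + 1 / real (s - i)) / real s)"
      unfolding pair_weight_def
      by (intro sum.cong refl) (auto simp: field_simps of_nat_diff)
    also have "\<dots> = ((\<Sum>i\<in>{1..<s}. 1 / real i) + (\<Sum>i\<in>{1..<s}. 1 / real (s - i))) / real s"
      by (simp add: sum_divide_distrib sum.distrib add_divide_distrib)
    also have "(\<Sum>i\<in>{1..<s}. 1 / real (s - i)) = (\<Sum>i\<in>{1..<s}. 1 / real i)"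
      by (rule sum.reindex_bij_witness[where i = "\<lambda>k. s - k" and j = "\<lambda>k. s - k"]) auto
    also have "(\<Sum>i\<in>{1..<s}. 1 / real i) \<le> harm s"
      unfolding harm_def by (auto intro!: sum_mono2 simp: field_simps)
    finally show ?thesis by (simp add: divide_right_mono)
  qed
  thus "eventually (\<lambda>s. pair_weight s \<le> 2 * (harm s / real s)) sequentially" by simp
  have "(\<lambda>s. (harm s - ln (real s)) * (1 / real s) + ln (real s) / real s) \<longlonglongrightarrow> euler_mascheroni * 0 + 0"
    by (intro tendsto_intros euler_mascheroni_LIMSEQ lim_ln_over_n lim_1_over_n)
  moreover have "eventually (\<lambda>s. (harm s - ln (real s)) * (1 / real s) + ln (real s) / real s = harm s / real s) sequentially"
    by (intro always_eventually allI) (simp add: diff_divide_distrib)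
  ultimately have "(\<lambda>s. harm s / real s) \<longlonglongrightarrow> 0"
    using Lim_transform_eventually by fastforce
  from tendsto_mult_left[OF this, of 2] show "(\<lambda>s. 2 * (harm s / real s)) \<longlonglongrightarrow> 0" by simp
qed (simp add: pair_weight_nonneg)

text \<open>Collect the terms by \<open>k = n - i - j\<close>.\<close>
lemma double_sum_eq_convolution:
  "(\<Sum>i=1..n. \<Sum>j=1..n-i. a (n - i - j) / (real i * real j)) = (\<Sum>k<n. a k * pair_weight (n - k))"
  for a :: "nat \<Rightarrow> real"
proof -
  have "(\<Sum>i=1..n. \<Sum>j=1..n-i. a (n - i - j) / (real i * real j))
      = (\<Sum>(i, j)\<in>(SIGMA i : {1..n}. {1..n-i}). a (n - i - j) / (real i * real j))"
    by (rule sum.Sigma) auto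
  also have "\<dots> = (\<Sum>(k, i)\<in>(SIGMA k : {..<n}. {1..<n-k}). a k * (1 / (real i * real (n - k - i))))"
    by (rule sum.reindex_bij_witness[where i = "\<lambda>(k, i). (i, n - k - i)" and j = "\<lambda>(i, j). (n - i - j, i)"])
       auto
  also have "\<dots> = (\<Sum>k<n. \<Sum>i\<in>{1..<n-k}. a k * (1 / (real i * real (n - k - i))))"
    by (rule sum.Sigma [symmetric]) auto
  finally show ?thesis by (simp add: pair_weight_def sum_distrib_left)
qed

text \<open>For each fixed \<open>k\<close> the \<open>k\<close>-th term tends to \<open>0\<close>, and the terms are dominated by the summable
  sequence \<open>a\<close>, so the limit may be taken termwise by Tannery's theorem.\<close>
lemma convolution_tendsto_zero:
  fixes a b :: "nat \<Rightarrow> real"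
  assumes a: "summable a" "\<And>n. a n \<ge> 0" and b: "b \<longlonglongrightarrow> 0" "\<And>n. \<bar>b n\<bar> \<le> 1"
  shows "(\<lambda>n. \<Sum>k<n. a k * b (n - k)) \<longlonglongrightarrow> 0"
proof -
  define f where "f = (\<lambda>k n. if k < n then a k * b (n - k) else 0)"
  have lim: "(\<lambda>n. f k n) \<longlonglongrightarrow> 0" for k
  proof (rule Lim_transform_eventually)
    have "(\<lambda>n. b (n - k)) \<longlonglongrightarrow> 0"
      using b(1) by (rule filterlim_compose) (rule filterlim_minus_const_nat_at_top)
    from tendsto_mult_left[OF this, of "a k"] show "(\<lambda>n. a k * b (n - k)) \<longlonglongrightarrow> 0" by simp
    show "eventually (\<lambda>n. a k * b (n - k) = f k n) sequentially"
      using eventually_gt_at_top[of k] by eventually_elim (simp add: f_def)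
  qed
  have "norm (f k n) \<le> a k" for k n
    using a(2)[of k] b(2)[of "n - k"] by (auto simp: f_def abs_mult intro: mult_left_le)
  hence "eventually (\<lambda>(k, n). norm (f k n) \<le> a k) (at_top \<times>\<^sub>F sequentially)"
    by (intro always_eventually) (simp add: case_prod_beta)
  with lim a(1) have "(\<lambda>n. \<Sum>k. f k n) \<longlonglongrightarrow> (\<Sum>k. 0)"
    using tannerys_theorem[of f "\<lambda>_. 0" sequentially a] by simp
  moreover have "(\<Sum>k. f k n) = (\<Sum>k<n. a k * b (n - k))" for n
    by (subst suminf_finite[of "{..<n}"]) (auto simp: f_def)
  ultimately show ?thesis by simp
qed

text \<open>The hypothesis bounds the ratio of consecutive partial sums by \<open>1 + \<bar>C\<bar>/n\<^sup>2\<close>, and the product of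
  these factors converges because the series of the \<open>1/n\<^sup>2\<close> does.\<close>
lemma summable_if_sq_mult_le_partial_sum:
  fixes a :: "nat \<Rightarrow> real"
  assumes nonneg: "\<And>n. a n \<ge> 0" and le: "\<And>n. (real n)\<^sup>2 * a n \<le> C * (\<Sum>k<n. a k)"
  shows "summable a"
proof -
  define S where "S = (\<lambda>n. \<Sum>k<Suc n. a k)"
  have S_nonneg: "S n \<ge> 0" for n unfolding S_def by (intro sum_nonneg nonneg)
  let ?q = "\<lambda>k. 1 / real (Suc k) ^ 2"
  have step: "S (Suc n) \<le> exp (\<bar>C\<bar> * ?q n) * S n" for n
  proof -
    have "(real (Suc n))\<^sup>2 * a (Suc n) \<le> C * S n" using le[of "Suc n"] by (simp add: S_def)
    also have "\<dots> \<le> \<bar>C\<bar> * S n" using S_nonneg by (intro mult_right_mono) auto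
    finally have "a (Suc n) \<le> \<bar>C\<bar> * ?q n * S n" by (simp add: field_simps)
    hence "S (Suc n) \<le> (1 + \<bar>C\<bar> * ?q n) * S n" by (simp add: S_def algebra_simps)
    also have "\<dots> \<le> exp (\<bar>C\<bar> * ?q n) * S n"
      using S_nonneg by (intro mult_right_mono exp_ge_add_one_self) auto
    finally show ?thesis .
  qed
  have bound: "S n \<le> exp (\<bar>C\<bar> * (\<Sum>k<n. ?q k)) * a 0" for n
  proof (induction n)
    case (Suc n)
    have "S (Suc n) \<le> exp (\<bar>C\<bar> * ?q n) * (exp (\<bar>C\<bar> * (\<Sum>k<n. ?q k)) * a 0)"
      using step[of n] Suc.IH by (meson exp_ge_zero mult_left_mono order_trans)
    also have "\<dots> = exp (\<bar>C\<bar> * (\<Sum>k<Suc n. ?q k)) * a 0"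
      by (simp only: sum.lessThan_Suc distrib_left exp_add mult_ac)
    finally show ?case .
  qed (simp add: S_def)
  have q: "summable ?q"
    using inverse_power_summable[of 2, where 'a = real]
    by (subst summable_Suc_iff) (simp only: inverse_eq_divide)
  have "S n \<le> exp (\<bar>C\<bar> * suminf ?q) * a 0" for n
  proof -
    have "(\<Sum>k<n. ?q k) \<le> suminf ?q" using q by (intro sum_le_suminf) auto
    hence "exp (\<bar>C\<bar> * (\<Sum>k<n. ?q k)) \<le> exp (\<bar>C\<bar> * suminf ?q)"
      by (simp add: mult_left_mono)
    thus ?thesis using bound[of n] nonneg[of 0] by (meson mult_right_mono order_trans)
  qed
  hence "(\<Sum>k\<le>n. a k) \<le> exp (\<bar>C\<bar> * suminf ?q) * a 0" for n
    by (simp add: S_def lessThan_Suc_atMost)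
  with nonneg show ?thesis by (intro bounded_imp_summable) auto
qed

section \<open>The asymptotic formula\<close>

theorem theorem1p5:
  shows "summable (\<lambda>n::nat. kappa (sym_group n))
    \<and> (\<lambda>n::nat. kappa (sym_group n)) \<sim>[at_top] (\<lambda>n. A_kappa / (real n)\<^sup>2)
    \<and> (\<lambda>n::nat. (real n)\<^sup>2 * kappa (sym_group n)) \<longlonglongrightarrow> A_kappa"
proof -
  define a where "a = (\<lambda>n. kappa (sym_group n))"
  define E where "E = (\<lambda>n. \<Sum>k<n. a k * pair_weight (n - k))"
  have nonneg: "a n \<ge> 0" for n by (simp add: a_def kappa_def)
  have lower: "(\<Sum>k<n. a k) \<le> (real n)\<^sup>2 * a n" for n
    unfolding a_def by (rule kappa_sym_group_bounds)
  have upper: "(real n)\<^sup>2 * a n \<le> (\<Sum>k<n. a k) + E n" for n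
    using kappa_sym_group_bounds(2)[of n]
    unfolding E_def a_def by (simp only: double_sum_eq_convolution[where a = "\<lambda>n. kappa (sym_group n)"])
  have E_le: "E n \<le> (\<Sum>k<n. a k)" for n
    unfolding E_def by (intro sum_mono mult_left_le pair_weight_le_one nonneg)
  have "(real n)\<^sup>2 * a n \<le> 2 * (\<Sum>k<n. a k)" for n
    using upper[of n] E_le[of n] by linarith
  with nonneg have summable: "summable a" by (rule summable_if_sq_mult_le_partial_sum)
  have E_limit: "E \<longlonglongrightarrow> 0"
    using convolution_tendsto_zero[of a pair_weight, OF summable nonneg pair_weight_tendsto_zero]
    by (simp only: E_def abs_of_nonneg[OF pair_weight_nonneg] pair_weight_le_one)
  have partial: "(\<lambda>n. \<Sum>k<n. a k) \<longlonglongrightarrow> A_kappa"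
    using summable_LIMSEQ[OF summable] by (simp add: A_kappa_def a_def)
  have upper_limit: "(\<lambda>n. (\<Sum>k<n. a k) + E n) \<longlonglongrightarrow> A_kappa"
    using tendsto_add[OF partial E_limit] by (simp only: add_0_right)
  have limit: "(\<lambda>n. (real n)\<^sup>2 * a n) \<longlonglongrightarrow> A_kappa"
    by (rule tendsto_sandwich[OF _ _ partial upper_limit])
       (intro always_eventually allI lower upper)+
  \<comment> \<open>Asymptotic equivalence is stronger than the limit only in needing a nonzero constant; the trivial
    group already contributes \<open>1\<close>.\<close>
  have "A_kappa > 0"
  proof -
    have "partitions_of 0 = {{#}}" by (auto simp: partitions_of_def) (metis multiset_nonemptyE)
    hence "a 0 = 1" by (simp add: a_def kappa_sym_group)
    moreover have "a 0 \<le> A_kappa"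
      using sum_le_suminf[OF summable, of "{0}"] nonneg by (simp add: A_kappa_def a_def)
    ultimately show ?thesis by simp
  qed
  have "a \<sim>[at_top] (\<lambda>n. A_kappa / (real n)\<^sup>2)"
  proof (rule asymp_equivI')
    have "(\<lambda>n. (real n)\<^sup>2 * a n / A_kappa) \<longlonglongrightarrow> A_kappa / A_kappa"
      using \<open>A_kappa > 0\<close> by (intro tendsto_intros limit) auto
    thus "(\<lambda>n. a n / (A_kappa / (real n)\<^sup>2)) \<longlonglongrightarrow> 1"
      using \<open>A_kappa > 0\<close> by (simp add: mult.commute)
  qed
  with summable limit show ?thesis unfolding a_def by blast
qed

end
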